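(* Let $V$ be a finite-dimensional vector space over $\mathbb{C}$ and let $\mathfrak{sl}(V)$ be the Lie algebra of $SL(V)$. For the adjoint action of $SL(V)$ on $\mathfrak{sl}(V)$, given by $\mathrm{Ad}(g)(x) = gxg^{-1}$, the group $SL(V)$ has Liouville property on the projective space $\mathbb{P}(\mathfrak{sl}(V))$.
   Context: $\mathfrak{sl}(V)$ is the space of all trace zero linear endomorphisms of $V$. For a vector space $W$, $\mathbb{P}(W)$ denotes the corresponding projective space (the space of one-dimensional subspaces of $W$; here $W=\mathfrak{sl}(V)$ is a complex vector space). Probability measures on a locally compact group $G$ are regular Borel probability measures. For such a measure $\mu$, $G_\mu$ (resp. $S_\mu$) denotes the closed subgroup (resp. closed subsemigroup) of $G$ generated by the support of $\mu$; $\mu$ is called irreducible if $S_\mu = G$. A $G$-space $E$ is a locally compact space with a continuous $G$-action. A bounded measurable function $f$ on $E$ is called $\mu$-harmonic if $\int f(gx)\,d\mu(g) = f(x)$ for all $x\in E$. The measure $\mu$ has Liouville property on $E$ if every continuous bounded $\mu$-harmonic function on $E$ is $G_\mu$-invariant. The group $G$ has Liouville property on $E$ if every irreducible probability measure on $G$ has Liouville property on $E$. *)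

theory Defs
  imports
    "HOL-Probability.Probability_Measure"
    "HOL-Algebra.Group"
    "HOL-Library.Function_Algebras"
begin

section \<open>Harmonic functions and the Liouville property\<close>

text \<open>
  A topological group is given by a group \<open>G\<close> together with a topology \<open>T\<close> on its carrier;
  a \<open>G\<close>-space is given by a topology \<open>E\<close> and an action \<open>act\<close> of \<open>G\<close> on \<open>topspace E\<close>.
\<close>

definition borel_of :: "'a topology \<Rightarrow> 'a measure" where
  "borel_of T = sigma (topspace T) {U. openin T U}"

definition regular_borel_prob :: "'a topology \<Rightarrow> 'a measure \<Rightarrow> bool" where
  "regular_borel_prob T \<mu> \<longleftrightarrow>
     prob_space \<mu> \<and> sets \<mu> = sets (borel_of T) \<and>
     (\<forall>A\<in>sets \<mu>. emeasure \<mu> A = (INF U\<in>{U. openin T U \<and> A \<subseteq> U}. emeasure \<mu> U)) \<and>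
     (\<forall>A\<in>sets \<mu>. emeasure \<mu> A = (SUP K\<in>{K. compactin T K \<and> K \<subseteq> A}. emeasure \<mu> K))"

definition measure_support :: "'a topology \<Rightarrow> 'a measure \<Rightarrow> 'a set" where
  "measure_support T \<mu> = {g \<in> topspace T. \<forall>U. openin T U \<and> g \<in> U \<longrightarrow> emeasure \<mu> U > 0}"

definition gen_closed_subgroup ::
  "('a, 'm) monoid_scheme \<Rightarrow> 'a topology \<Rightarrow> 'a measure \<Rightarrow> 'a set" where
  "gen_closed_subgroup G T \<mu> =
     \<Inter>{H. subgroup H G \<and> closedin T H \<and> measure_support T \<mu> \<subseteq> H}"

definition gen_closed_subsemigroup ::
  "('a, 'm) monoid_scheme \<Rightarrow> 'a topology \<Rightarrow> 'a measure \<Rightarrow> 'a set" where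
  "gen_closed_subsemigroup G T \<mu> =
     \<Inter>{S. (\<forall>g\<in>S. \<forall>h\<in>S. g \<otimes>\<^bsub>G\<^esub> h \<in> S) \<and> closedin T S \<and> measure_support T \<mu> \<subseteq> S}"

definition irreducible_measure ::
  "('a, 'm) monoid_scheme \<Rightarrow> 'a topology \<Rightarrow> 'a measure \<Rightarrow> bool" where
  "irreducible_measure G T \<mu> \<longleftrightarrow> gen_closed_subsemigroup G T \<mu> = carrier G"

definition harmonic ::
  "'a measure \<Rightarrow> 'e topology \<Rightarrow> ('a \<Rightarrow> 'e \<Rightarrow> 'e) \<Rightarrow> ('e \<Rightarrow> complex) \<Rightarrow> bool" where
  "harmonic \<mu> E act f \<longleftrightarrow>
     bounded (f ` topspace E) \<and> f \<in> borel_measurable (borel_of E) \<and>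
     (\<forall>x\<in>topspace E. (\<integral>g. f (act g x) \<partial>\<mu>) = f x)"

definition measure_liouville ::
  "('a, 'm) monoid_scheme \<Rightarrow> 'a topology \<Rightarrow> 'a measure \<Rightarrow>
   'e topology \<Rightarrow> ('a \<Rightarrow> 'e \<Rightarrow> 'e) \<Rightarrow> bool" where
  "measure_liouville G T \<mu> E act \<longleftrightarrow>
     (\<forall>f. continuous_map E euclidean f \<and> harmonic \<mu> E act f \<longrightarrow>
        (\<forall>g\<in>gen_closed_subgroup G T \<mu>. \<forall>x\<in>topspace E. f (act g x) = f x))"

definition group_liouville ::
  "('a, 'm) monoid_scheme \<Rightarrow> 'a topology \<Rightarrow> 'e topology \<Rightarrow> ('a \<Rightarrow> 'e \<Rightarrow> 'e) \<Rightarrow> bool" where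
  "group_liouville G T E act \<longleftrightarrow>
     (\<forall>\<mu>. regular_borel_prob T \<mu> \<and> irreducible_measure G T \<mu> \<longrightarrow>
        measure_liouville G T \<mu> E act)"

section \<open>Projective spaces\<close>

definition one_dim_subspaces ::
  "(complex \<Rightarrow> 'w \<Rightarrow> 'w) \<Rightarrow> 'w::ab_group_add set \<Rightarrow> 'w set set" where
  "one_dim_subspaces sc W = {L. module.subspace sc L \<and> L \<subseteq> W \<and> vector_space.dim sc L = 1}"

text \<open>
  The quotient topology for the map sending a nonzero vector of \<open>W\<close> to the line it spans,
  where \<open>T\<close> is the topology of the ambient space.
\<close>

definition proj_space ::
  "(complex \<Rightarrow> 'w \<Rightarrow> 'w) \<Rightarrow> 'w::ab_group_add topology \<Rightarrow> 'w set \<Rightarrow> 'w set topology" where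
  "proj_space sc T W = topology (\<lambda>U. U \<subseteq> one_dim_subspaces sc W \<and>
     openin (subtopology T (W - {0})) {x \<in> W - {0}. module.span sc {x} \<in> U})"

lemma openin_proj_space:
  "openin (proj_space sc T W) U \<longleftrightarrow> U \<subseteq> one_dim_subspaces sc W \<and>
     openin (subtopology T (W - {0})) {x \<in> W - {0}. module.span sc {x} \<in> U}"
proof -
  let ?pre = "\<lambda>U. {x \<in> W - {0}. module.span sc {x} \<in> U}"
  have "istopology (\<lambda>U. U \<subseteq> one_dim_subspaces sc W \<and> openin (subtopology T (W - {0})) (?pre U))"
    unfolding istopology_def
  proof (intro conjI allI impI)
    fix S U assume *: "S \<subseteq> one_dim_subspaces sc W \<and> openin (subtopology T (W - {0})) (?pre S)"
      "U \<subseteq> one_dim_subspaces sc W \<and> openin (subtopology T (W - {0})) (?pre U)"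
    show "S \<inter> U \<subseteq> one_dim_subspaces sc W" using * by blast
    have "?pre (S \<inter> U) = ?pre S \<inter> ?pre U" by blast
    then show "openin (subtopology T (W - {0})) (?pre (S \<inter> U))"
      using * by (metis (no_types, lifting) openin_Int)
  next
    fix \<K> assume *: "\<forall>K\<in>\<K>. K \<subseteq> one_dim_subspaces sc W \<and> openin (subtopology T (W - {0})) (?pre K)"
    show "\<Union>\<K> \<subseteq> one_dim_subspaces sc W" using * by blast
    have "?pre (\<Union>\<K>) = \<Union>(?pre ` \<K>)" by blast
    moreover have "openin (subtopology T (W - {0})) (\<Union>(?pre ` \<K>))"
      using * by (intro openin_Union) blast
    ultimately show "openin (subtopology T (W - {0})) (?pre (\<Union>\<K>))" by (simp only:)
  qed
  then show ?thesis
    unfolding proj_space_def by (simp add: topology_inverse')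
qed

section \<open>The special linear group and its Lie algebra\<close>

text \<open>
  Here \<open>smul\<close> is the scalar multiplication of a complex vector space and \<open>B\<close> a finite basis.
  Trace, determinant and topology are defined through matrix entries with respect to \<open>B\<close>;
  none of them depends on the choice of \<open>B\<close>.
\<close>

definition endos :: "(complex \<Rightarrow> 'v \<Rightarrow> 'v) \<Rightarrow> ('v::ab_group_add \<Rightarrow> 'v) set" where
  "endos smul = {f. Vector_Spaces.linear smul smul f}"

definition endo_scale :: "(complex \<Rightarrow> 'v \<Rightarrow> 'v) \<Rightarrow> complex \<Rightarrow> ('v \<Rightarrow> 'v) \<Rightarrow> 'v \<Rightarrow> 'v" where
  "endo_scale smul c f = (\<lambda>v. smul c (f v))"

definition endo_entry ::
  "(complex \<Rightarrow> 'v \<Rightarrow> 'v) \<Rightarrow> 'v::ab_group_add set \<Rightarrow> ('v \<Rightarrow> 'v) \<Rightarrow> 'v \<Rightarrow> 'v \<Rightarrow> complex" where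
  "endo_entry smul B f i j = module.representation smul B (f j) i"

definition endo_trace ::
  "(complex \<Rightarrow> 'v \<Rightarrow> 'v) \<Rightarrow> 'v::ab_group_add set \<Rightarrow> ('v \<Rightarrow> 'v) \<Rightarrow> complex" where
  "endo_trace smul B f = (\<Sum>i\<in>B. endo_entry smul B f i i)"

definition endo_det ::
  "(complex \<Rightarrow> 'v \<Rightarrow> 'v) \<Rightarrow> 'v::ab_group_add set \<Rightarrow> ('v \<Rightarrow> 'v) \<Rightarrow> complex" where
  "endo_det smul B f =
     (\<Sum>p | p permutes B. of_int (sign p) * (\<Prod>i\<in>B. endo_entry smul B f i (p i)))"

definition endo_topology ::
  "(complex \<Rightarrow> 'v \<Rightarrow> 'v) \<Rightarrow> 'v::ab_group_add set \<Rightarrow> ('v \<Rightarrow> 'v) topology" where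
  "endo_topology smul B =
     pullback_topology (endos smul) (\<lambda>f. \<lambda>(i, j)\<in>B \<times> B. endo_entry smul B f i j)
       (product_topology (\<lambda>_. euclidean) (B \<times> B))"

definition SL :: "(complex \<Rightarrow> 'v \<Rightarrow> 'v) \<Rightarrow> 'v::ab_group_add set \<Rightarrow> ('v \<Rightarrow> 'v) monoid" where
  "SL smul B =
     \<lparr>carrier = {g \<in> endos smul. endo_det smul B g = 1}, mult = (\<circ>), one = id\<rparr>"

definition SL_topology ::
  "(complex \<Rightarrow> 'v \<Rightarrow> 'v) \<Rightarrow> 'v::ab_group_add set \<Rightarrow> ('v \<Rightarrow> 'v) topology" where
  "SL_topology smul B = subtopology (endo_topology smul B) (carrier (SL smul B))"

definition sl :: "(complex \<Rightarrow> 'v \<Rightarrow> 'v) \<Rightarrow> 'v::ab_group_add set \<Rightarrow> ('v \<Rightarrow> 'v) set" where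
  "sl smul B = {x \<in> endos smul. endo_trace smul B x = 0}"

definition Ad ::
  "(complex \<Rightarrow> 'v \<Rightarrow> 'v) \<Rightarrow> 'v::ab_group_add set \<Rightarrow> ('v \<Rightarrow> 'v) \<Rightarrow> ('v \<Rightarrow> 'v) \<Rightarrow> ('v \<Rightarrow> 'v)" where
  "Ad smul B g x = g \<circ> x \<circ> inv\<^bsub>SL smul B\<^esub> g"

definition proj_sl ::
  "(complex \<Rightarrow> 'v \<Rightarrow> 'v) \<Rightarrow> 'v::ab_group_add set \<Rightarrow> ('v \<Rightarrow> 'v) set topology" where
  "proj_sl smul B = proj_space (endo_scale smul) (endo_topology smul B) (sl smul B)"

end

theory Submission
  imports Defs "Jordan_Normal_Form.Determinant"
begin

text \<open>
  Every continuous bounded harmonic function \<open>f\<close> on the projective space of \<open>sl(V)\<close> is constant,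
  because \<open>SL(V)\<close> has only one minimal closed invariant set there.

  The maximum principle reduces the problem to this fact.  For a fixed point \<open>z\<close>, the set where
  \<open>norm (f - f z)\<close> attains its maximum is nonempty by compactness, and it is mapped into itself by
  every element of the support of the measure, since an average of vectors of norm at most \<open>M\<close> has
  norm \<open>M\<close> only if almost all of them do.  The elements that map it into itself form a closed
  semigroup; by irreducibility this is the whole group.  If \<open>z\<close> lies in every nonempty closed
  invariant set, then it lies in this one and the maximum is zero
  (\<open>group_liouville_if_point_in_closed_invariant_sets\<close>).

  Such a point is the line of a matrix unit \<open>E\<^sub>p\<^sub>q\<close> with \<open>p \<noteq> q\<close>: the lines spanned by
  nilpotents of rank one form the orbit of the highest weight line.  To see that its line belongs
  to each nonempty closed invariant set, start with any nonzero \<open>x\<close> of trace zero.  It is not a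
  scalar, so, after conjugation by a transvection if necessary, it has a nonzero entry off the diagonal, say at
  \<open>(a, b)\<close> (\<open>some_matrix_unit\<close>).  Conjugation by the diagonal endomorphisms with entries
  \<open>1 / s\<close> at \<open>a\<close> and \<open>s\<close> at \<open>b\<close> lets this entry dominate as \<open>s\<close> tends to \<open>0\<close>, so
  the lines converge to that of \<open>E\<^sub>a\<^sub>b\<close> (\<open>matrix_unit_if_entry_nonzero\<close>).  Further
  transvections and limits lead from \<open>E\<^sub>a\<^sub>b\<close> to \<open>E\<^sub>p\<^sub>q\<close> (\<open>all_matrix_units\<close>).

  The remaining ingredients are the compactness of the projective space and the continuity of
  \<open>g \<mapsto> g x g\<^sup>-\<^sup>1\<close>; the latter holds because the inverse of an element of \<open>SL(V)\<close> is its
  adjugate, whose entries are polynomials in those of \<open>g\<close>.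
\<close>

section \<open>Liouville property from a point in all closed invariant sets\<close>

lemma space_borel_of: "space (borel_of T) = topspace T"
  unfolding borel_of_def by (rule space_measure_of) (auto dest: openin_subset)

lemma sets_borel_of_openin: "openin T U \<Longrightarrow> U \<in> sets (borel_of T)"
  unfolding borel_of_def by (subst sets_measure_of) (auto dest: openin_subset)

lemma continuous_map_borel_of_measurable:
  assumes "continuous_map T euclidean f"
  shows "f \<in> borel_measurable (borel_of T)"
proof (rule borel_measurableI)
  fix S :: "'b set" assume "open S"
  then have "openin T {x \<in> topspace T. f x \<in> S}"
    by (intro openin_continuous_map_preimage[OF assms]) (simp add: open_openin[symmetric])
  moreover have "f -` S \<inter> space (borel_of T) = {x \<in> topspace T. f x \<in> S}"
    by (auto simp: space_borel_of)
  ultimately show "f -` S \<inter> space (borel_of T) \<in> sets (borel_of T)"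
    by (simp add: sets_borel_of_openin)
qed

text \<open>
  The equality case of the triangle inequality for integrals: \<open>M - norm \<circ> \<phi>\<close> is nonnegative
  with integral at most zero, so it vanishes almost everywhere; by continuity it then vanishes at
  every point of the support, since it would otherwise be positive on a set of positive measure.
\<close>

lemma norm_eq_on_support_if_integral_extremal:
  fixes \<phi> :: "'a \<Rightarrow> complex"
  assumes "prob_space \<mu>" and sets: "sets \<mu> = sets (borel_of T)"
    and cont: "continuous_map T euclidean \<phi>"
    and bound: "\<And>g. g \<in> topspace T \<Longrightarrow> norm (\<phi> g) \<le> M"
    and extremal: "norm (\<integral>g. \<phi> g \<partial>\<mu>) = M"
    and g: "g \<in> measure_support T \<mu>"
  shows "norm (\<phi> g) = M"
proof -
  interpret prob_space \<mu> by fact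
  have space: "space \<mu> = topspace T"
    using sets_eq_imp_space_eq[OF sets] by (simp add: space_borel_of)
  have meas: "\<phi> \<in> borel_measurable \<mu>"
    using continuous_map_borel_of_measurable[OF cont] measurable_cong_sets[OF sets refl] by blast
  have int: "integrable \<mu> \<phi>"
    by (rule integrable_const_bound[of _ M]) (use bound meas in \<open>auto simp: space\<close>)
  have int': "integrable \<mu> (\<lambda>g. M - norm (\<phi> g))"
    using int by (intro Bochner_Integration.integrable_diff integrable_norm) auto
  have nonneg: "AE g in \<mu>. 0 \<le> M - norm (\<phi> g)"
    by (rule AE_I2) (use bound in \<open>auto simp: space\<close>)
  have "M \<le> (\<integral>g. norm (\<phi> g) \<partial>\<mu>)"
    using integral_norm_bound[of \<mu> \<phi>] extremal by simp
  moreover have "(\<integral>g. M - norm (\<phi> g) \<partial>\<mu>) = M - (\<integral>g. norm (\<phi> g) \<partial>\<mu>)"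
    using int by (subst Bochner_Integration.integral_diff) (auto simp: prob_space)
  moreover have "(\<integral>g. M - norm (\<phi> g) \<partial>\<mu>) \<ge> 0"
    by (rule integral_nonneg_AE[OF nonneg])
  ultimately have "(\<integral>g. M - norm (\<phi> g) \<partial>\<mu>) = 0" by simp
  then have ae: "AE g in \<mu>. M - norm (\<phi> g) = 0"
    using integral_nonneg_eq_0_iff_AE[OF int' nonneg] by simp
  let ?U = "{g \<in> topspace T. \<phi> g \<in> {z. norm z < M}}"
  have op: "openin T ?U"
    by (rule openin_continuous_map_preimage[OF cont])
       (simp add: open_openin[symmetric] open_Collect_less continuous_on_norm_id)
  have "emeasure \<mu> ?U = 0"
  proof -
    have "?U \<in> sets \<mu>" using sets_borel_of_openin[OF op] sets by simp
    moreover have "AE g in \<mu>. g \<notin> ?U" using ae by eventually_elim auto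
    ultimately show ?thesis by (simp add: AE_iff_measurable[OF _ refl] space AE_iff_null_sets null_setsD1)
  qed
  moreover have "g \<in> topspace T" and "openin T ?U \<Longrightarrow> g \<in> ?U \<Longrightarrow> emeasure \<mu> ?U > 0"
    using g unfolding measure_support_def by blast+
  ultimately have "\<not> norm (\<phi> g) < M" using op by auto
  then show ?thesis using bound[OF \<open>g \<in> topspace T\<close>] by simp
qed

text \<open>
  Let \<open>f\<close> be a continuous harmonic function.  The set where \<open>norm (f - f z)\<close> attains its maximum
  is stable under the support of the measure by the equality case above, hence under the closed
  semigroup generated by it, which is the whole group.  So this closed invariant set contains \<open>z\<close>,
  where the function vanishes: the maximum is zero and \<open>f\<close> is constant.
\<close>

lemma group_liouville_if_point_in_closed_invariant_sets:
  fixes G (structure)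
  assumes "group G" and carrier: "topspace T = carrier G"
    and compact: "compact_space E"
    and act_closed: "\<And>g x. g \<in> carrier G \<Longrightarrow> x \<in> topspace E \<Longrightarrow> act g x \<in> topspace E"
    and act_mult: "\<And>g h x. g \<in> carrier G \<Longrightarrow> h \<in> carrier G \<Longrightarrow> x \<in> topspace E \<Longrightarrow>
        act (g \<otimes> h) x = act g (act h x)"
    and act_cont: "\<And>x. x \<in> topspace E \<Longrightarrow> continuous_map T E (\<lambda>g. act g x)"
    and z: "\<And>C. closedin E C \<Longrightarrow> C \<noteq> {} \<Longrightarrow> (\<And>g x. g \<in> carrier G \<Longrightarrow> x \<in> C \<Longrightarrow> act g x \<in> C) \<Longrightarrow> z \<in> C"
  shows "group_liouville G T E act"
  unfolding group_liouville_def measure_liouville_def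
proof (intro allI impI ballI)
  interpret group G by fact
  fix \<mu> f g x
  assume \<mu>: "regular_borel_prob T \<mu> \<and> irreducible_measure G T \<mu>"
    and f: "continuous_map E euclidean f \<and> harmonic \<mu> E act f"
    and g: "g \<in> gen_closed_subgroup G T \<mu>" and x: "x \<in> topspace E"
  have prob: "prob_space \<mu>" and sets: "sets \<mu> = sets (borel_of T)"
    using \<mu> unfolding regular_borel_prob_def by auto
  interpret prob_space \<mu> by fact
  have space: "space \<mu> = topspace T"
    using sets_eq_imp_space_eq[OF sets] by (simp add: space_borel_of)
  have cf: "continuous_map E euclidean f" using f by simp
  define h where "h = (\<lambda>y. norm (f y - f z))"
  have ch: "continuous_map E euclideanreal h"
    unfolding h_def by (intro continuous_intros cf) auto
  have "compactin euclideanreal (h ` topspace E)"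
    by (rule image_compactin[OF _ ch]) (use compact in \<open>simp add: compact_space_def\<close>)
  then obtain s where "s \<in> h ` topspace E" and "\<forall>t\<in>h ` topspace E. t \<le> s"
    using compact_attains_sup[of "h ` topspace E"] x unfolding compactin_euclidean_iff by blast
  then obtain y where y: "y \<in> topspace E" and max: "\<And>u. u \<in> topspace E \<Longrightarrow> h u \<le> h y"
    by blast
  define C where "C = {u \<in> topspace E. h u \<in> {h y}}"
  have closed_C: "closedin E C"
    unfolding C_def by (rule closedin_continuous_map_preimage[OF ch]) simp
  have step: "act k u \<in> C" if k: "k \<in> measure_support T \<mu>" and u: "u \<in> C" for k u
  proof -
    have uE: "u \<in> topspace E" and hu: "h u = h y" using u by (auto simp: C_def)
    have kG: "k \<in> carrier G" using k by (auto simp: measure_support_def carrier)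
    have cfu: "continuous_map T euclidean (\<lambda>k. f (act k u))"
      using continuous_map_compose[OF act_cont[OF uE] cf] by (simp add: o_def)
    have "integrable \<mu> (\<lambda>k. f (act k u))"
    proof -
      obtain b where b: "\<And>v. v \<in> topspace E \<Longrightarrow> norm (f v) \<le> b"
        using f unfolding harmonic_def bounded_iff by auto
      have "(\<lambda>k. f (act k u)) \<in> borel_measurable \<mu>"
        using continuous_map_borel_of_measurable[OF cfu] measurable_cong_sets[OF sets refl] by blast
      then show ?thesis
        by (intro integrable_const_bound[of _ b]) (use b act_closed uE carrier in \<open>auto simp: space\<close>)
    qed
    then have "(\<integral>k. f (act k u) - f z \<partial>\<mu>) = (\<integral>k. f (act k u) \<partial>\<mu>) - f z"
      by (subst Bochner_Integration.integral_diff) (auto simp: prob_space)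
    also have "\<dots> = f u - f z" using f uE unfolding harmonic_def by simp
    finally have "norm (\<integral>k. f (act k u) - f z \<partial>\<mu>) = h y" using hu by (simp add: h_def)
    then have "norm (f (act k u) - f z) = h y"
      by (rule norm_eq_on_support_if_integral_extremal[OF prob sets _ _ _ k, rotated 2])
         (use max act_closed uE carrier in \<open>auto simp: h_def intro!: continuous_intros cfu\<close>)
    then show ?thesis using act_closed[OF kG uE] by (simp add: C_def h_def)
  qed
  define S where "S = {k \<in> carrier G. \<forall>u\<in>C. act k u \<in> C}"
  have "closedin T S"
  proof -
    have "S = topspace T \<inter> (\<Inter>u\<in>C. {k \<in> topspace T. act k u \<in> C})"
      by (auto simp: S_def carrier)
    moreover have "closedin T {k \<in> topspace T. act k u \<in> C}" if "u \<in> C" for u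
      using that by (intro closedin_continuous_map_preimage[OF act_cont closed_C]) (auto simp: C_def)
    moreover have "C \<noteq> {}" using y by (auto simp: C_def)
    ultimately show ?thesis by (metis (no_types, lifting) closedin_INT closedin_Int closedin_topspace)
  qed
  moreover have "\<forall>k\<in>S. \<forall>l\<in>S. k \<otimes> l \<in> S"
    by (auto simp: S_def act_mult C_def)
  moreover have "measure_support T \<mu> \<subseteq> S"
    using step by (auto simp: S_def measure_support_def carrier)
  ultimately have "gen_closed_subsemigroup G T \<mu> \<subseteq> S"
    unfolding gen_closed_subsemigroup_def by blast
  then have "carrier G \<subseteq> S" using \<mu> by (simp add: irreducible_measure_def)
  then have "z \<in> C"
    using y by (intro z closed_C) (auto simp: S_def C_def)
  then have "h y = 0" by (simp add: C_def h_def)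
  then have const: "f u = f z" if "u \<in> topspace E" for u
    using max[OF that] by (simp add: h_def)
  have "g \<in> carrier G"
    using g subgroup_self unfolding gen_closed_subgroup_def
    by (auto simp: carrier[symmetric] measure_support_def)
  then show "f (act g x) = f x" using const x act_closed by simp
qed


section \<open>Continuity of products and determinants\<close>

lemma continuous_map_mult:
  fixes f g :: "'x \<Rightarrow> 'y::real_normed_algebra"
  assumes "continuous_map X euclidean f" "continuous_map X euclidean g"
  shows "continuous_map X euclidean (\<lambda>x. f x * g x)"
  using assms by (simp add: continuous_map_atin tendsto_mult)

lemma continuous_map_prod_complex:
  fixes f :: "'x \<Rightarrow> 'i \<Rightarrow> complex"
  assumes "\<And>i. i \<in> I \<Longrightarrow> continuous_map X euclidean (\<lambda>x. f x i)"
  shows "continuous_map X euclidean (\<lambda>x. \<Prod>i\<in>I. f x i)"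
  using assms by (simp add: continuous_map_atin tendsto_prod)

lemma continuous_map_det:
  fixes A :: "'x \<Rightarrow> complex mat"
  assumes carrier: "\<And>x. A x \<in> carrier_mat n n"
    and cont: "\<And>k l. k < n \<Longrightarrow> l < n \<Longrightarrow> continuous_map X euclidean (\<lambda>x. A x $$ (k, l))"
  shows "continuous_map X euclidean (\<lambda>x. Determinant.det (A x))"
proof -
  have "Determinant.det (A x) =
      (\<Sum>p | p permutes {0..<n}. signof p * (\<Prod>k = 0..<n. A x $$ (k, p k)))" for x
    by (rule det_def'[OF carrier])
  moreover have "p k < n" if "p permutes {0..<n}" "k < n" for p k
    using permutes_in_image[OF that(1), of k] that(2) by simp
  ultimately show ?thesis
    by (auto intro!: continuous_map_sum continuous_map_mult continuous_map_prod_complex cont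
        simp: finite_permutations)
qed

section \<open>Endomorphisms and their matrix entries\<close>

locale complex_basis = finite_dimensional_vector_space smul B
  for smul :: "complex \<Rightarrow> 'v::ab_group_add \<Rightarrow> 'v" and B :: "'v set"
begin

abbreviation rep :: "'v \<Rightarrow> 'v \<Rightarrow> complex" where
  "rep \<equiv> representation B"

abbreviation entry :: "('v \<Rightarrow> 'v) \<Rightarrow> 'v \<Rightarrow> 'v \<Rightarrow> complex" where
  "entry \<equiv> endo_entry smul B"

text \<open>
  As for \<open>endo_entry\<close>, the first index is the row.
\<close>

definition of_entries :: "('v \<Rightarrow> 'v \<Rightarrow> complex) \<Rightarrow> 'v \<Rightarrow> 'v" where
  "of_entries M v = (\<Sum>j\<in>B. \<Sum>i\<in>B. smul (M i j * rep v j) i)"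

lemma rep_add: "rep (v + w) i = rep v i + rep w i"
  by (simp add: representation_add[OF independent_Basis] span_Basis)

lemma rep_scale: "rep (smul c v) i = c * rep v i"
  by (simp add: representation_scale[OF independent_Basis] span_Basis)

lemma rep_sum: "rep (\<Sum>k\<in>K. f k) i = (\<Sum>k\<in>K. rep (f k) i)"
  by (simp add: representation_sum[OF independent_Basis] span_Basis)

lemma rep_basis: "j \<in> B \<Longrightarrow> rep j i = (if i = j then 1 else 0)"
  by (simp add: representation_basis[OF independent_Basis])

lemma rep_expand: "(\<Sum>j\<in>B. smul (rep v j) j) = v"
  by (rule sum_representation_eq[OF independent_Basis _ finite_Basis]) (auto simp: span_Basis)

lemma endo_scale_arg: "f \<in> endos smul \<Longrightarrow> f (smul c v) = smul c (f v)"
proof -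
  assume "f \<in> endos smul"
  then interpret f: Vector_Spaces.linear smul smul f by (simp add: endos_def)
  show ?thesis by (rule f.scale)
qed

lemma endo_expand:
  assumes "f \<in> endos smul"
  shows "f v = (\<Sum>j\<in>B. smul (rep v j) (f j))"
proof -
  interpret f: Vector_Spaces.linear smul smul f using assms by (simp add: endos_def)
  show ?thesis by (subst (1) rep_expand[symmetric]) (simp add: f.sum f.scale)
qed

lemma endo_eqI:
  assumes "f \<in> endos smul" "g \<in> endos smul"
    and "\<And>i j. i \<in> B \<Longrightarrow> j \<in> B \<Longrightarrow> entry f i j = entry g i j"
  shows "f = g"
proof
  fix v
  have "f j = g j" if "j \<in> B" for j
  proof -
    have "rep (f j) i = rep (g j) i" if "i \<in> B" for i
      using assms(3)[OF that \<open>j \<in> B\<close>] by (simp add: endo_entry_def)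
    then show ?thesis by (subst (1 2) rep_expand[symmetric]) simp
  qed
  then show "f v = g v"
    by (simp add: endo_expand[OF assms(1), of v] endo_expand[OF assms(2), of v])
qed

lemma of_entries_endo: "of_entries M \<in> endos smul"
  unfolding endos_def of_entries_def mem_Collect_eq
  by unfold_locales
     (simp_all add: rep_add rep_scale algebra_simps scale_left_distrib sum.distrib scale_sum_right)

lemma entry_of_entries: "i \<in> B \<Longrightarrow> j \<in> B \<Longrightarrow> entry (of_entries M) i j = M i j"
proof -
  assume "i \<in> B" "j \<in> B"
  have "entry (of_entries M) i j = (\<Sum>l\<in>B. \<Sum>k\<in>B. M k l * rep j l * rep k i)"
    unfolding endo_entry_def of_entries_def by (simp add: rep_sum rep_scale)
  also have "\<dots> = (\<Sum>l\<in>B. \<Sum>k\<in>B. if k = i then if l = j then M i j else 0 else 0)"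
    using \<open>j \<in> B\<close> by (intro sum.cong refl) (simp add: rep_basis)
  finally show ?thesis
    using \<open>i \<in> B\<close> \<open>j \<in> B\<close> by (simp add: finite_Basis)
qed

lemma entry_comp:
  assumes "f \<in> endos smul"
  shows "entry (f \<circ> g) i j = (\<Sum>k\<in>B. entry f i k * entry g k j)"
  unfolding endo_entry_def o_def
  by (subst endo_expand[OF assms]) (simp add: rep_sum rep_scale mult.commute)

lemma entry_id: "j \<in> B \<Longrightarrow> entry id i j = (if i = j then 1 else 0)"
  by (simp add: endo_entry_def rep_basis)

lemma entry_scale: "entry (endo_scale smul c f) i j = c * entry f i j"
  by (simp add: endo_entry_def endo_scale_def rep_scale)

lemma endos_comp: "f \<in> endos smul \<Longrightarrow> g \<in> endos smul \<Longrightarrow> f \<circ> g \<in> endos smul"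
  unfolding endos_def by (auto intro: Vector_Spaces.linear_compose)

lemma endos_id: "id \<in> endos smul"
  unfolding endos_def by (simp add: linear_id)

lemma endos_scale: "f \<in> endos smul \<Longrightarrow> endo_scale smul c f \<in> endos smul"
proof -
  assume "f \<in> endos smul"
  then interpret f: Vector_Spaces.linear smul smul f by (simp add: endos_def)
  show ?thesis unfolding endos_def endo_scale_def mem_Collect_eq
    by unfold_locales (simp_all add: f.add f.scale algebra_simps)
qed

sublocale endo: vector_space "endo_scale smul :: complex \<Rightarrow> ('v \<Rightarrow> 'v) \<Rightarrow> 'v \<Rightarrow> 'v"
  by unfold_locales (auto simp: endo_scale_def fun_eq_iff algebra_simps)

lemma trace_comp_commute:
  assumes "f \<in> endos smul" "g \<in> endos smul"
  shows "endo_trace smul B (f \<circ> g) = endo_trace smul B (g \<circ> f)"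
  unfolding endo_trace_def entry_comp[OF assms(1)] entry_comp[OF assms(2)]
  by (subst sum.swap) (simp add: mult.commute)

section \<open>The special linear group\<close>

text \<open>
  Numbering the basis transports determinants and adjugates from matrices indexed by an
  initial segment of the natural numbers.
\<close>

definition enum :: "nat \<Rightarrow> 'v" where
  "enum = (SOME e. bij_betw e {0..<card B} B)"

definition index :: "'v \<Rightarrow> nat" where
  "index = inv_into {0..<card B} enum"

definition to_mat :: "('v \<Rightarrow> 'v) \<Rightarrow> complex mat" where
  "to_mat f = mat (card B) (card B) (\<lambda>(k, l). entry f (enum k) (enum l))"

definition adjugate :: "('v \<Rightarrow> 'v) \<Rightarrow> 'v \<Rightarrow> 'v" where
  "adjugate f = of_entries (\<lambda>i j. adj_mat (to_mat f) $$ (index i, index j))"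

lemma bij_enum: "bij_betw enum {0..<card B} B"
  unfolding enum_def
  by (rule someI_ex[of "\<lambda>e. bij_betw e {0..<card B} B"])
     (rule ex_bij_betw_nat_finite[OF finite_Basis])

lemma enum_in: "k < card B \<Longrightarrow> enum k \<in> B"
  using bij_enum by (auto simp: bij_betw_def)

lemma index_less: "i \<in> B \<Longrightarrow> index i < card B"
  unfolding index_def using bij_betw_inv_into[OF bij_enum] by (auto simp: bij_betw_def)

lemma enum_index: "i \<in> B \<Longrightarrow> enum (index i) = i"
  unfolding index_def by (rule bij_betw_inv_into_right[OF bij_enum])

lemma index_enum: "k < card B \<Longrightarrow> index (enum k) = k"
  unfolding index_def by (rule bij_betw_inv_into_left[OF bij_enum]) simp

lemma to_mat_carrier: "to_mat f \<in> carrier_mat (card B) (card B)"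
  by (simp add: to_mat_def)

lemma to_mat_comp:
  assumes "f \<in> endos smul"
  shows "to_mat (f \<circ> g) = to_mat f * to_mat g"
proof (rule eq_matI)
  fix k l assume "k < dim_row (to_mat f * to_mat g)" "l < dim_col (to_mat f * to_mat g)"
  then have "k < card B" "l < card B" by (auto simp: to_mat_def)
  moreover have "(\<Sum>m = 0..<card B. entry f (enum k) (enum m) * entry g (enum m) (enum l)) =
      (\<Sum>b\<in>B. entry f (enum k) b * entry g b (enum l))"
    by (rule sum.reindex_bij_betw[OF bij_enum])
  ultimately show "to_mat (f \<circ> g) $$ (k, l) = (to_mat f * to_mat g) $$ (k, l)"
    by (simp add: to_mat_def entry_comp[OF assms] times_mat_def scalar_prod_def)
qed (auto simp: to_mat_def)

lemma det_to_mat: "Determinant.det (to_mat f) = endo_det smul B f"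
proof -
  let ?m = "map_permutation {0..<card B} enum"
  have inj: "inj_on enum {0..<card B}" using bij_enum by (simp add: bij_betw_def)
  have bij: "bij_betw ?m {p. p permutes {0..<card B}} {p. p permutes B}"
    using bij_betw_permutations[OF bij_enum] bij_enum
    by (simp add: map_permutation_def[abs_def] restrict_id_def bij_betw_def o_def)
  have "endo_det smul B f = (\<Sum>p | p permutes {0..<card B}.
      of_int (sign (?m p)) * (\<Prod>i\<in>B. entry f i (?m p i)))"
    unfolding endo_det_def by (rule sum.reindex_bij_betw[OF bij, symmetric])
  also have "\<dots> = (\<Sum>p | p permutes {0..<card B}.
      of_int (sign p) * (\<Prod>k = 0..<card B. entry f (enum k) (enum (p k))))"
  proof (rule sum.cong[OF refl], unfold mem_Collect_eq)
    fix p assume p: "p permutes {0..<card B}"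
    have "(\<Prod>i\<in>B. entry f i (?m p i)) = (\<Prod>k = 0..<card B. entry f (enum k) (?m p (enum k)))"
      by (rule prod.reindex_bij_betw[OF bij_enum, symmetric])
    also have "\<dots> = (\<Prod>k = 0..<card B. entry f (enum k) (enum (p k)))"
      by (intro prod.cong refl) (simp add: map_permutation_apply[OF inj])
    finally show "of_int (sign (?m p)) * (\<Prod>i\<in>B. entry f i (?m p i)) =
        of_int (sign p) * (\<Prod>k = 0..<card B. entry f (enum k) (enum (p k)))"
      by (simp add: sign_map_permutation[OF inj p])
  qed
  also have "\<dots> = Determinant.det (to_mat f)"
    unfolding Determinant.det_def
    by (auto simp: to_mat_def permutes_in_image intro!: sum.cong prod.cong)
  finally show ?thesis by simp
qed

lemma endo_det_comp:
  assumes "f \<in> endos smul"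
  shows "endo_det smul B (f \<circ> g) = endo_det smul B f * endo_det smul B g"
  by (simp add: det_to_mat[symmetric] to_mat_comp[OF assms]
      Determinant.det_mult[OF to_mat_carrier to_mat_carrier])

lemma to_mat_id: "to_mat id = 1\<^sub>m (card B)"
  using bij_enum by (auto simp: to_mat_def entry_id enum_in bij_betw_def inj_on_def intro!: eq_matI)

lemma endo_det_id: "endo_det smul B id = 1"
  by (simp add: det_to_mat[symmetric] to_mat_id)

lemma entry_to_mat: "i \<in> B \<Longrightarrow> j \<in> B \<Longrightarrow> entry f i j = to_mat f $$ (index i, index j)"
  by (simp add: to_mat_def index_less enum_index)

lemma to_mat_inj: "f \<in> endos smul \<Longrightarrow> g \<in> endos smul \<Longrightarrow> to_mat f = to_mat g \<Longrightarrow> f = g"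
  by (rule endo_eqI) (auto simp: entry_to_mat)

lemma to_mat_adjugate: "to_mat (adjugate f) = adj_mat (to_mat f)"
proof (rule eq_matI)
  fix k l assume "k < dim_row (adj_mat (to_mat f))" "l < dim_col (adj_mat (to_mat f))"
  then have "k < card B" "l < card B"
    using adj_mat(1)[OF to_mat_carrier, of f] by auto
  then show "to_mat (adjugate f) $$ (k, l) = adj_mat (to_mat f) $$ (k, l)"
    unfolding to_mat_def[of "adjugate f"]
    by (simp add: adjugate_def entry_of_entries enum_in index_enum)
qed (use adj_mat(1)[OF to_mat_carrier, of f] to_mat_carrier[of "adjugate f"] in auto)

lemma adjugate_endo: "adjugate f \<in> endos smul"
  unfolding adjugate_def by (rule of_entries_endo)

lemma adjugate_inverse:
  assumes f: "f \<in> endos smul" and "endo_det smul B f = 1"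
  shows "f \<circ> adjugate f = id" "adjugate f \<circ> f = id"
proof -
  have 1: "Determinant.det (to_mat f) \<cdot>\<^sub>m 1\<^sub>m (card B) = to_mat id"
    using assms by (auto simp: det_to_mat to_mat_id intro!: eq_matI)
  show "f \<circ> adjugate f = id"
    by (rule to_mat_inj) (auto simp: f adjugate_endo endos_comp endos_id to_mat_comp
        to_mat_adjugate adj_mat(2)[OF to_mat_carrier] 1)
  show "adjugate f \<circ> f = id"
    by (rule to_mat_inj) (auto simp: f adjugate_endo endos_comp endos_id to_mat_comp
        to_mat_adjugate adj_mat(3)[OF to_mat_carrier] 1)
qed

lemma carrier_SL: "g \<in> carrier (SL smul B) \<longleftrightarrow> g \<in> endos smul \<and> endo_det smul B g = 1"
  by (simp add: SL_def)

lemma mult_SL: "g \<otimes>\<^bsub>SL smul B\<^esub> h = g \<circ> h"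
  by (simp add: SL_def)

lemma one_SL: "\<one>\<^bsub>SL smul B\<^esub> = id"
  by (simp add: SL_def)

lemma adjugate_SL:
  assumes "g \<in> carrier (SL smul B)"
  shows "adjugate g \<in> carrier (SL smul B)"
proof -
  have "endo_det smul B (g \<circ> adjugate g) = 1"
    using assms by (simp add: adjugate_inverse carrier_SL endo_det_id)
  then show ?thesis using assms by (simp add: carrier_SL endo_det_comp adjugate_endo)
qed

lemma group_SL: "group (SL smul B)"
proof (rule groupI)
  fix g assume "g \<in> carrier (SL smul B)"
  then show "\<exists>h\<in>carrier (SL smul B). h \<otimes>\<^bsub>SL smul B\<^esub> g = \<one>\<^bsub>SL smul B\<^esub>"
    using adjugate_SL adjugate_inverse(2) by (force simp: mult_SL one_SL carrier_SL)
qed (auto simp: carrier_SL mult_SL one_SL endos_comp endos_id endo_det_id endo_det_comp o_assoc)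

sublocale SL: group "SL smul B"
  by (rule group_SL)

lemma inv_SL: "g \<in> carrier (SL smul B) \<Longrightarrow> inv\<^bsub>SL smul B\<^esub> g = adjugate g"
  using adjugate_SL[of g] adjugate_inverse(2)[of g]
  by (intro SL.inv_equality) (simp_all add: carrier_SL mult_SL one_SL)

section \<open>Continuity of the adjoint action\<close>

lemma topspace_endo_topology: "topspace (endo_topology smul B) = endos smul"
  by (auto simp: endo_topology_def topspace_pullback_topology)

lemma continuous_map_entry:
  assumes "i \<in> B" "j \<in> B"
  shows "continuous_map (endo_topology smul B) euclidean (\<lambda>f. entry f i j)"
proof -
  have "continuous_map (product_topology (\<lambda>_. euclidean) (B \<times> B)) euclidean (\<lambda>m. m (i, j))"
    using assms by (intro continuous_map_product_projection) simp
  from continuous_map_pullback[OF this] show ?thesis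
    unfolding endo_topology_def
    by (rule continuous_map_eq) (use assms in \<open>auto simp: o_def\<close>)
qed

lemma continuous_map_into_endo:
  assumes "\<And>x. x \<in> topspace X \<Longrightarrow> F x \<in> endos smul"
    and "\<And>i j. i \<in> B \<Longrightarrow> j \<in> B \<Longrightarrow> continuous_map X euclidean (\<lambda>x. entry (F x) i j)"
  shows "continuous_map X (endo_topology smul B) F"
  unfolding endo_topology_def
proof (rule continuous_map_pullback')
  show "continuous_map X (product_topology (\<lambda>_. euclidean) (B \<times> B))
      ((\<lambda>f. \<lambda>(i, j)\<in>B \<times> B. entry f i j) \<circ> F)"
    unfolding continuous_map_componentwise using assms(2) by auto
qed (use assms(1) in auto)

text \<open>
  Inversion is continuous on the special linear group because the adjugate has polynomial entries.
\<close>

lemma continuous_map_adjugate: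
  "continuous_map (endo_topology smul B) (endo_topology smul B) adjugate"
proof (rule continuous_map_into_endo)
  fix i j assume ij: "i \<in> B" "j \<in> B"
  have "continuous_map (endo_topology smul B) euclidean
      (\<lambda>f. Determinant.det (mat_delete (to_mat f) (index j) (index i)))"
  proof (rule continuous_map_det)
    show "mat_delete (to_mat f) (index j) (index i) \<in> carrier_mat (card B - 1) (card B - 1)" for f
      by (rule mat_delete_carrier[OF to_mat_carrier])
    show "continuous_map (endo_topology smul B) euclidean
        (\<lambda>f. mat_delete (to_mat f) (index j) (index i) $$ (k, l))"
      if "k < card B - 1" "l < card B - 1" for k l
      using that by (auto simp: mat_delete_def to_mat_def intro!: continuous_map_entry enum_in)
  qed
  then have "continuous_map (endo_topology smul B) euclidean
      (\<lambda>f. (-1) ^ (index j + index i) *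
        Determinant.det (mat_delete (to_mat f) (index j) (index i)))"
    by (intro continuous_map_mult) auto
  then show "continuous_map (endo_topology smul B) euclidean (\<lambda>f. entry (adjugate f) i j)"
    using ij by (simp add: adjugate_def entry_of_entries adj_mat_def cofactor_def index_less
        to_mat_carrier[THEN carrier_matD(1)] to_mat_carrier[THEN carrier_matD(2)])
qed (rule adjugate_endo)

lemma continuous_map_comp_endo:
  assumes "continuous_map X (endo_topology smul B) F" "continuous_map X (endo_topology smul B) F'"
  shows "continuous_map X (endo_topology smul B) (\<lambda>x. F x \<circ> F' x)"
proof (rule continuous_map_into_endo)
  have endo: "F x \<in> endos smul" "F' x \<in> endos smul" if "x \<in> topspace X" for x
    using assms that by (auto simp: continuous_map_def topspace_endo_topology Pi_iff)
  then show "F x \<circ> F' x \<in> endos smul" if "x \<in> topspace X" for x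
    using that by (simp add: endos_comp)
  fix i j assume "i \<in> B" "j \<in> B"
  then have "continuous_map X euclidean (\<lambda>x. \<Sum>k\<in>B. entry (F x) i k * entry (F' x) k j)"
    using continuous_map_compose[OF assms(1) continuous_map_entry]
      continuous_map_compose[OF assms(2) continuous_map_entry]
    by (intro continuous_map_sum continuous_map_mult) (auto simp: o_def finite_Basis)
  then show "continuous_map X euclidean (\<lambda>x. entry (F x \<circ> F' x) i j)"
    by (rule continuous_map_eq) (simp add: entry_comp endo)
qed

lemma topspace_SL: "topspace (SL_topology smul B) = carrier (SL smul B)"
  by (auto simp: SL_topology_def topspace_endo_topology carrier_SL)

lemma Ad_SL: "g \<in> carrier (SL smul B) \<Longrightarrow> Ad smul B g x = g \<circ> x \<circ> adjugate g"
  by (simp add: Ad_def inv_SL)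

lemma continuous_map_Ad:
  assumes "x \<in> endos smul"
  shows "continuous_map (SL_topology smul B) (endo_topology smul B) (\<lambda>g. Ad smul B g x)"
proof (rule continuous_map_eq)
  show "continuous_map (SL_topology smul B) (endo_topology smul B) (\<lambda>g. g \<circ> x \<circ> adjugate g)"
    unfolding SL_topology_def
    by (intro continuous_map_from_subtopology continuous_map_comp_endo continuous_map_adjugate)
       (use assms in \<open>auto simp: topspace_endo_topology\<close>)
qed (simp add: topspace_SL Ad_SL)

section \<open>The projective space of trace-zero endomorphisms\<close>

abbreviation line :: "('v \<Rightarrow> 'v) \<Rightarrow> ('v \<Rightarrow> 'v) set" where
  "line x \<equiv> module.span (endo_scale smul) {x}"

lemma line_eq: "line x = range (\<lambda>c. endo_scale smul c x)"
  by (rule endo.span_singleton)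

lemma line_scale:
  assumes "c \<noteq> 0"
  shows "line (endo_scale smul c x) = line x"
proof -
  have "endo_scale smul k x \<in> range (\<lambda>k. endo_scale smul k (endo_scale smul c x))" for k
    by (rule range_eqI[of _ _ "k / c"]) (use assms in simp)
  moreover have "endo_scale smul k (endo_scale smul c x) \<in> range (\<lambda>k. endo_scale smul k x)" for k
    by (rule range_eqI[of _ _ "k * c"]) simp
  ultimately show ?thesis unfolding line_eq by blast
qed

lemma sl_endo: "x \<in> sl smul B \<Longrightarrow> x \<in> endos smul"
  by (simp add: sl_def)

lemma sl_scale: "x \<in> sl smul B \<Longrightarrow> endo_scale smul c x \<in> sl smul B"
  by (simp add: sl_def endos_scale endo_trace_def entry_scale sum_distrib_left[symmetric])

lemma one_dim_subspaces_sl: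
  "one_dim_subspaces (endo_scale smul) (sl smul B) = line ` (sl smul B - {0})"
proof (intro equalityI subsetI)
  fix L assume L: "L \<in> one_dim_subspaces (endo_scale smul) (sl smul B)"
  then have dim: "endo.dim L = 1" and sub: "endo.subspace L" "L \<subseteq> sl smul B"
    by (auto simp: one_dim_subspaces_def)
  obtain X where X: "X \<subseteq> L" "endo.independent X" "L \<subseteq> endo.span X" "card X = endo.dim L"
    by (rule endo.basis_exists)
  then obtain x where x: "X = {x}" using dim card_1_singletonE by metis
  have "x \<noteq> 0" using X(2) x endo.dependent_zero by auto
  moreover have "L = line x"
    using X(1,3) x endo.span_minimal[OF _ sub(1)] by blast
  ultimately show "L \<in> line ` (sl smul B - {0})" using X(1) x sub(2) by blast
next
  fix L assume "L \<in> line ` (sl smul B - {0})"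
  then obtain x where x: "x \<in> sl smul B" "x \<noteq> 0" "L = line x" by blast
  have "endo.dim (line x) = 1"
    using x(2) endo.dim_span_eq_card_independent[of "{x}"] by simp
  then show "L \<in> one_dim_subspaces (endo_scale smul) (sl smul B)"
    using x sl_scale by (auto simp: one_dim_subspaces_def line_eq[symmetric]) (auto simp: line_eq)
qed

lemma topspace_endo_minus_zero:
  "topspace (subtopology (endo_topology smul B) (sl smul B - {0})) = sl smul B - {0}"
  by (auto simp: topspace_endo_topology sl_endo)

lemma topspace_proj_sl: "topspace (proj_sl smul B) = line ` (sl smul B - {0})"
proof -
  have "{x \<in> sl smul B - {0}. line x \<in> line ` (sl smul B - {0})} = sl smul B - {0}" by auto
  then have "openin (proj_sl smul B) (line ` (sl smul B - {0}))"
    unfolding proj_sl_def openin_proj_space one_dim_subspaces_sl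
    using openin_topspace[of "subtopology (endo_topology smul B) (sl smul B - {0})"]
    unfolding topspace_endo_minus_zero by simp
  moreover have "topspace (proj_sl smul B) \<subseteq> line ` (sl smul B - {0})"
    using openin_topspace[of "proj_sl smul B"]
    unfolding proj_sl_def openin_proj_space one_dim_subspaces_sl by simp
  ultimately show ?thesis by (simp add: openin_subset subset_antisym)
qed

lemma continuous_map_line:
  "continuous_map (subtopology (endo_topology smul B) (sl smul B - {0})) (proj_sl smul B) line"
  unfolding continuous_map_alt topspace_proj_sl topspace_endo_minus_zero
proof (intro conjI allI impI)
  fix U assume "openin (proj_sl smul B) U"
  then have "openin (subtopology (endo_topology smul B) (sl smul B - {0}))
      {x \<in> sl smul B - {0}. line x \<in> U}"
    by (simp add: proj_sl_def openin_proj_space)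
  moreover have "{x \<in> sl smul B - {0}. line x \<in> U} = line -` U \<inter> (sl smul B - {0})" by blast
  ultimately show "openin (subtopology (endo_topology smul B) (sl smul B - {0}))
      (line -` U \<inter> (sl smul B - {0}))" by simp
qed auto

lemma continuous_map_line_comp:
  assumes "continuous_map X (endo_topology smul B) F"
    and "\<And>x. x \<in> topspace X \<Longrightarrow> F x \<in> sl smul B - {0}"
  shows "continuous_map X (proj_sl smul B) (\<lambda>x. line (F x))"
  using continuous_map_compose[OF _ continuous_map_line, of X F] assms
  by (auto simp: continuous_map_in_subtopology o_def)

lemma nonzero_entry:
  assumes "x \<in> endos smul" "x \<noteq> 0"
  obtains i j where "i \<in> B" "j \<in> B" "entry x i j \<noteq> 0"
proof -
  have "(0 :: 'v \<Rightarrow> 'v) \<in> endos smul" using endos_scale[OF assms(1), of 0] by simp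
  moreover have "entry 0 i j = 0" for i j using entry_scale[of 0 x i j] by simp
  ultimately show thesis using endo_eqI[OF assms(1)] assms(2) that by metis
qed

text \<open>
  The space is a continuous image of a compact set: every line contains an endomorphism whose
  entries have absolute values adding up to one, and the matrices of trace zero with this
  normalization form a closed subset of a product of discs.
\<close>

lemma compact_proj_sl: "compact_space (proj_sl smul B)"
proof -
  let ?P = "product_topology (\<lambda>_. euclidean) (B \<times> B) :: ('v \<times> 'v \<Rightarrow> complex) topology"
  let ?\<Phi> = "\<lambda>m :: 'v \<times> 'v \<Rightarrow> complex. of_entries (\<lambda>i j. m (i, j))"
  let ?N = "\<lambda>m. \<Sum>p\<in>B \<times> B. norm (m p)"
  let ?tr = "\<lambda>m. \<Sum>i\<in>B. m (i, i)"
  have proj: "continuous_map ?P euclidean (\<lambda>m. m p)" if "p \<in> B \<times> B" for p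
    using that by (rule continuous_map_product_projection)
  have fin: "finite (B \<times> B)" using finite_Basis by simp
  define K where "K = {m \<in> topspace ?P. ?N m \<in> {1}} \<inter> {m \<in> topspace ?P. ?tr m \<in> {0}}"
  have "closedin ?P K"
    unfolding K_def
    by (intro closedin_Int closedin_continuous_map_preimage[where Y = euclidean] continuous_map_sum
        continuous_map_norm proj fin finite_Basis) auto
  moreover have "K \<subseteq> (\<Pi>\<^sub>E p\<in>B \<times> B. cball 0 1)"
  proof
    fix m assume m: "m \<in> K"
    have "norm (m p) \<le> ?N m" if "p \<in> B \<times> B" for p
      using that by (intro member_le_sum) (auto simp: fin)
    then show "m \<in> (\<Pi>\<^sub>E p\<in>B \<times> B. cball 0 1)"
      using m by (auto simp: K_def PiE_iff)
  qed
  moreover have "compactin ?P (\<Pi>\<^sub>E p\<in>B \<times> B. cball 0 1)"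
    by (simp add: compactin_PiE)
  ultimately have K: "compactin ?P K" using closed_compactin by blast
  have tr: "endo_trace smul B (?\<Phi> m) = ?tr m" for m
    by (simp add: endo_trace_def entry_of_entries)
  have \<Phi>_K: "?\<Phi> m \<in> sl smul B - {0}" if m: "m \<in> K" for m
  proof -
    have "?\<Phi> m \<noteq> 0"
    proof
      assume "?\<Phi> m = 0"
      moreover have "entry 0 i j = 0" for i j using entry_scale[of 0 id i j] by simp
      ultimately have "m p = 0" if "p \<in> B \<times> B" for p
        using that entry_of_entries[of "fst p" "snd p" "\<lambda>i j. m (i, j)"] by auto
      then show False using m by (simp add: K_def)
    qed
    then show ?thesis using m tr by (simp add: sl_def of_entries_endo K_def)
  qed
  have "continuous_map (subtopology ?P K) (proj_sl smul B) (\<lambda>m. line (?\<Phi> m))"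
    by (intro continuous_map_line_comp continuous_map_from_subtopology continuous_map_into_endo)
       (use \<Phi>_K in \<open>auto simp: of_entries_endo entry_of_entries intro: proj\<close>)
  then have "compactin (proj_sl smul B) ((\<lambda>m. line (?\<Phi> m)) ` K)"
    by (rule image_compactin[rotated]) (use K in \<open>simp add: compactin_subtopology\<close>)
  moreover have "topspace (proj_sl smul B) \<subseteq> (\<lambda>m. line (?\<Phi> m)) ` K"
  proof
    fix L assume "L \<in> topspace (proj_sl smul B)"
    then obtain x where x: "x \<in> sl smul B" "x \<noteq> 0" "L = line x" by (auto simp: topspace_proj_sl)
    define N where "N = (\<Sum>(i, j)\<in>B \<times> B. norm (entry x i j))"
    have "N > 0"
    proof -
      obtain i j where "i \<in> B" "j \<in> B" "entry x i j \<noteq> 0"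
        using nonzero_entry[OF sl_endo[OF x(1)] x(2)] .
      then show ?thesis
        unfolding N_def by (intro sum_pos2[of _ "(i, j)"]) (auto simp: fin)
    qed
    define y where "y = endo_scale smul (of_real (1 / N)) x"
    define m where "m = (\<lambda>(i, j)\<in>B \<times> B. entry y i j)"
    have y: "y \<in> sl smul B" unfolding y_def by (rule sl_scale[OF x(1)])
    have "?N m = (\<Sum>(i, j)\<in>B \<times> B. norm (entry x i j) / N)"
      using \<open>N > 0\<close> by (intro sum.cong) (auto simp: m_def y_def entry_scale norm_divide)
    also have "\<dots> = 1"
      using \<open>N > 0\<close> by (simp add: N_def case_prod_unfold sum_divide_distrib[symmetric])
    finally have "?N m = 1" .
    moreover have "?tr m = 0" using y by (simp add: m_def sl_def endo_trace_def)
    ultimately have "m \<in> K" by (simp add: K_def) (simp add: m_def)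
    moreover have "?\<Phi> m = y"
      by (rule endo_eqI) (auto simp: of_entries_endo entry_of_entries m_def sl_endo y)
    moreover have "line y = L"
      unfolding y_def x(3) by (rule line_scale) (use \<open>N > 0\<close> in simp)
    ultimately show "L \<in> (\<lambda>m. line (?\<Phi> m)) ` K" by (intro image_eqI[of _ _ m]) auto
  qed
  ultimately show ?thesis
    unfolding compact_space_def by (metis compactin_subset_topspace subset_antisym)
qed

lemma Ad_line:
  assumes "g \<in> carrier (SL smul B)"
  shows "Ad smul B g ` line x = line (Ad smul B g x)"
proof -
  have "Ad smul B g (endo_scale smul c x) = endo_scale smul c (Ad smul B g x)" for c
    using assms by (simp add: Ad_def endo_scale_def o_def carrier_SL endo_scale_arg)
  then show ?thesis unfolding line_eq image_image by (simp only:)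
qed

lemma Ad_mult:
  assumes "g \<in> carrier (SL smul B)" "h \<in> carrier (SL smul B)"
  shows "Ad smul B (g \<otimes>\<^bsub>SL smul B\<^esub> h) x = Ad smul B g (Ad smul B h x)"
  by (simp add: Ad_def SL.inv_mult_group assms) (simp add: mult_SL o_assoc)

text \<open>Conjugation preserves the trace, and it is injective.\<close>

lemma Ad_sl:
  assumes g: "g \<in> carrier (SL smul B)" and x: "x \<in> sl smul B - {0}"
  shows "Ad smul B g x \<in> sl smul B - {0}"
proof -
  let ?g' = "adjugate g"
  have endo: "g \<in> endos smul" "x \<in> endos smul" "?g' \<in> endos smul"
    using g x by (auto simp: carrier_SL sl_endo adjugate_endo)
  have inv: "?g' \<circ> g = id" using g by (simp add: carrier_SL adjugate_inverse)
  have "endo_trace smul B (g \<circ> x \<circ> ?g') = endo_trace smul B (?g' \<circ> (g \<circ> x))"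
    by (rule trace_comp_commute) (simp_all add: endo endos_comp)
  also have "?g' \<circ> (g \<circ> x) = x" by (simp add: o_assoc inv)
  finally have "endo_trace smul B (g \<circ> x \<circ> ?g') = endo_trace smul B x" .
  then have "g \<circ> x \<circ> ?g' \<in> sl smul B"
    using x endo endos_comp unfolding sl_def Diff_iff mem_Collect_eq by metis
  moreover have "g \<circ> x \<circ> ?g' \<noteq> 0"
  proof
    assume zero: "g \<circ> x \<circ> ?g' = 0"
    have "x = (?g' \<circ> g) \<circ> x \<circ> (?g' \<circ> g)" by (simp only: inv id_comp comp_id)
    also have "\<dots> = ?g' \<circ> (g \<circ> x \<circ> ?g') \<circ> g" by (simp only: o_assoc)
    also have "\<dots> = 0"
      unfolding zero using endo_scale_arg[OF endo(3), of 0 0] by (simp add: fun_eq_iff)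
    finally show False using x by blast
  qed
  ultimately show ?thesis by (simp add: Ad_SL[OF g])
qed

section \<open>Transvections, diagonal endomorphisms and matrix units\<close>

text \<open>
  A permutation other than the identity moves at least two indices, so it picks an off-diagonal
  zero in one of the other rows and contributes nothing to the determinant.
\<close>

lemma endo_det_all_but_one_row_diagonal:
  assumes "\<And>i j. i \<in> B \<Longrightarrow> j \<in> B \<Longrightarrow> i \<noteq> a \<Longrightarrow> i \<noteq> j \<Longrightarrow> entry f i j = 0"
  shows "endo_det smul B f = (\<Prod>i\<in>B. entry f i i)"
proof -
  have "of_int (sign p) * (\<Prod>i\<in>B. entry f i (p i)) = 0" if p: "p permutes B" "p \<noteq> id" for p
  proof -
    have "\<exists>i\<in>B. i \<noteq> a \<and> p i \<noteq> i"
    proof (rule ccontr)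
      assume "\<not> ?thesis"
      then have fixed: "p i = i" if "i \<noteq> a" for i
        using that permutes_not_in[OF p(1)] by blast
      then have "p a = a" using permutes_inj[OF p(1)] by (metis injD)
      then have "p = id" using fixed by (metis eq_id_iff)
      then show False using p(2) by simp
    qed
    then obtain i where "i \<in> B" "i \<noteq> a" "p i \<noteq> i" by blast
    then have "entry f i (p i) = 0"
      using assms permutes_in_image[OF p(1)] by metis
    then have "(\<Prod>i\<in>B. entry f i (p i)) = 0"
      using \<open>i \<in> B\<close> finite_Basis by (meson prod_zero)
    then show ?thesis by simp
  qed
  then have "endo_det smul B f =
      (\<Sum>p\<in>{id}. of_int (sign p) * (\<Prod>i\<in>B. entry f i (p i)))"
    unfolding endo_det_def
    by (intro sum.mono_neutral_right) (auto simp: finite_permutations finite_Basis permutes_id)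
  then show ?thesis by simp
qed

definition transvection :: "'v \<Rightarrow> 'v \<Rightarrow> complex \<Rightarrow> 'v \<Rightarrow> 'v" where
  "transvection a b c = of_entries (\<lambda>i j. (if i = j then 1 else 0) + (if i = a \<and> j = b then c else 0))"

definition diagonal :: "('v \<Rightarrow> complex) \<Rightarrow> 'v \<Rightarrow> 'v" where
  "diagonal d = of_entries (\<lambda>i j. if i = j then d i else 0)"

definition matrix_unit :: "'v \<Rightarrow> 'v \<Rightarrow> 'v \<Rightarrow> 'v" where
  "matrix_unit a b = of_entries (\<lambda>i j. if i = a \<and> j = b then 1 else 0)"

lemma transvection_endo: "transvection a b c \<in> endos smul"
  unfolding transvection_def by (rule of_entries_endo)

lemma diagonal_endo: "diagonal d \<in> endos smul"
  unfolding diagonal_def by (rule of_entries_endo)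

lemma entry_matrix_unit:
  "i \<in> B \<Longrightarrow> j \<in> B \<Longrightarrow> entry (matrix_unit a b) i j = (if i = a \<and> j = b then 1 else 0)"
  by (simp add: matrix_unit_def entry_of_entries)

lemma entry_transvection_comp:
  assumes "b \<in> B" "i \<in> B"
  shows "entry (transvection a b c \<circ> f) i j = entry f i j + (if i = a then c * entry f b j else 0)"
proof -
  have "entry (transvection a b c \<circ> f) i j =
      (\<Sum>k\<in>B. (if k = i then entry f i j else 0) + (if k = b then if i = a then c * entry f b j else 0 else 0))"
    unfolding entry_comp[OF transvection_endo]
    using assms by (intro sum.cong) (auto simp: transvection_def entry_of_entries algebra_simps)
  then show ?thesis using assms by (simp add: sum.distrib finite_Basis)
qed

lemma entry_comp_transvection:
  assumes "f \<in> endos smul" "a \<in> B" "j \<in> B"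
  shows "entry (f \<circ> transvection a b c) i j = entry f i j + (if j = b then entry f i a * c else 0)"
proof -
  have "entry (f \<circ> transvection a b c) i j =
      (\<Sum>k\<in>B. (if k = j then entry f i j else 0) + (if k = a then if j = b then entry f i a * c else 0 else 0))"
    unfolding entry_comp[OF assms(1)]
    using assms by (intro sum.cong) (auto simp: transvection_def entry_of_entries algebra_simps)
  then show ?thesis using assms by (simp add: sum.distrib finite_Basis)
qed

lemma entry_diagonal_comp:
  assumes "i \<in> B"
  shows "entry (diagonal d \<circ> f) i j = d i * entry f i j"
proof -
  have "entry (diagonal d \<circ> f) i j = (\<Sum>k\<in>B. if k = i then d i * entry f i j else 0)"
    unfolding entry_comp[OF diagonal_endo]
    using assms by (intro sum.cong) (auto simp: diagonal_def entry_of_entries)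
  then show ?thesis using assms by (simp add: finite_Basis)
qed

lemma entry_comp_diagonal:
  assumes "f \<in> endos smul" "j \<in> B"
  shows "entry (f \<circ> diagonal d) i j = entry f i j * d j"
proof -
  have "entry (f \<circ> diagonal d) i j = (\<Sum>k\<in>B. if k = j then entry f i j * d j else 0)"
    unfolding entry_comp[OF assms(1)]
    using assms by (intro sum.cong) (auto simp: diagonal_def entry_of_entries)
  then show ?thesis using assms by (simp add: finite_Basis)
qed

lemma transvection_SL:
  assumes "a \<noteq> b"
  shows "transvection a b c \<in> carrier (SL smul B)"
proof -
  have "endo_det smul B (transvection a b c) = (\<Prod>i\<in>B. entry (transvection a b c) i i)"
    by (rule endo_det_all_but_one_row_diagonal[of a]) (simp add: transvection_def entry_of_entries)
  also have "\<dots> = 1"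
    using assms by (intro prod.neutral) (auto simp: transvection_def entry_of_entries)
  finally show ?thesis by (simp add: carrier_SL transvection_endo)
qed

lemma Ad_eq_if_inverse:
  assumes "g \<in> carrier (SL smul B)" "g' \<in> carrier (SL smul B)" "g' \<circ> g = id"
  shows "Ad smul B g x = g \<circ> x \<circ> g'"
  using assms SL.inv_equality[of g' g] by (simp add: Ad_def mult_SL one_SL)

lemma entry_Ad_transvection:
  assumes "a \<noteq> b" "a \<in> B" "b \<in> B" "i \<in> B" "j \<in> B" "x \<in> endos smul"
  shows "entry (Ad smul B (transvection a b c) x) i j =
    entry x i j + (if i = a then c * entry x b j else 0)
    - (if j = b then c * (entry x i a + (if i = a then c * entry x b a else 0)) else 0)"
proof -
  have "transvection a b (- c) \<circ> transvection a b c = id"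
  proof (rule endo_eqI)
    fix k l assume "k \<in> B" "l \<in> B"
    then show "entry (transvection a b (- c) \<circ> transvection a b c) k l = entry id k l"
      using assms unfolding entry_transvection_comp[OF \<open>b \<in> B\<close> \<open>k \<in> B\<close>]
      by (auto simp: transvection_def entry_of_entries entry_id)
  qed (simp_all add: endos_comp endos_id transvection_endo)
  then have "Ad smul B (transvection a b c) x = transvection a b c \<circ> x \<circ> transvection a b (- c)"
    using assms by (intro Ad_eq_if_inverse transvection_SL)
  then show ?thesis
    using assms
    by (simp add: entry_comp_transvection endos_comp transvection_endo entry_transvection_comp algebra_simps)
qed

(* A diagonal endomorphism has no exceptional row, so the row to be left out is arbitrary. *)
lemma diagonal_SL: "(\<Prod>i\<in>B. d i) = 1 \<Longrightarrow> diagonal d \<in> carrier (SL smul B)"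
  using endo_det_all_but_one_row_diagonal[of undefined "diagonal d"]
  by (simp add: carrier_SL diagonal_endo) (simp add: diagonal_def entry_of_entries cong: prod.cong)

lemma entry_Ad_diagonal:
  assumes "(\<Prod>i\<in>B. d i) = 1" "\<And>i. d i \<noteq> 0" "i \<in> B" "j \<in> B" "x \<in> endos smul"
  shows "entry (Ad smul B (diagonal d) x) i j = d i * entry x i j / d j"
proof -
  let ?d' = "\<lambda>i. inverse (d i)"
  have "diagonal ?d' \<circ> diagonal d = id"
  proof (rule endo_eqI)
    fix k l assume "k \<in> B" "l \<in> B"
    then show "entry (diagonal ?d' \<circ> diagonal d) k l = entry id k l"
      using assms(2) by (simp add: entry_diagonal_comp) (simp add: diagonal_def entry_of_entries entry_id)
  qed (simp_all add: endos_comp endos_id diagonal_endo)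
  then have "Ad smul B (diagonal d) x = diagonal d \<circ> x \<circ> diagonal ?d'"
    using assms(1) by (intro Ad_eq_if_inverse diagonal_SL) (simp_all add: prod_inversef[unfolded o_def])
  then show ?thesis
    using assms
    by (simp add: entry_comp_diagonal endos_comp diagonal_endo entry_diagonal_comp field_simps)
qed

lemma matrix_unit_sl: "a \<in> B \<Longrightarrow> b \<in> B \<Longrightarrow> a \<noteq> b \<Longrightarrow> matrix_unit a b \<in> sl smul B - {0}"
proof -
  assume ab: "a \<in> B" "b \<in> B" "a \<noteq> b"
  then have "endo_trace smul B (matrix_unit a b) = 0"
    unfolding endo_trace_def by (intro sum.neutral) (auto simp: entry_matrix_unit)
  moreover have "matrix_unit a b \<noteq> 0"
    using ab entry_scale[of 0 "matrix_unit a b" a b] entry_matrix_unit[of a b a b] by auto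
  ultimately show ?thesis by (simp add: sl_def) (simp add: matrix_unit_def of_entries_endo)
qed

section \<open>Closed invariant sets of lines of trace-zero endomorphisms\<close>

context
  fixes C :: "('v \<Rightarrow> 'v) set set"
  assumes closed: "closedin (proj_sl smul B) C"
    and invariant: "\<And>g L. g \<in> carrier (SL smul B) \<Longrightarrow> L \<in> C \<Longrightarrow> Ad smul B g ` L \<in> C"
begin

lemma cone_invariant:
  "g \<in> carrier (SL smul B) \<Longrightarrow> line x \<in> C \<Longrightarrow> line (Ad smul B g x) \<in> C"
  using invariant Ad_line by metis

text \<open>
  A closed condition on \<open>s\<close> that holds for all \<open>s \<noteq> 0\<close> holds at \<open>0\<close>, as \<open>0\<close> is not an isolated
  point of the complex plane.
\<close>

lemma cone_limit:
  fixes F :: "complex \<Rightarrow> 'v \<Rightarrow> 'v"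
  assumes cont: "continuous_map euclidean (endo_topology smul B) F"
    and F: "\<And>s. F s \<in> sl smul B - {0}"
    and lines: "\<And>s. s \<noteq> 0 \<Longrightarrow> line (F s) \<in> C"
  shows "line (F 0) \<in> C"
proof (rule ccontr)
  assume "line (F 0) \<notin> C"
  moreover have "closedin euclidean {s \<in> topspace euclidean. line (F s) \<in> C}"
    by (intro closedin_continuous_map_preimage[OF _ closed] continuous_map_line_comp cont F)
  then have "open (- {s. line (F s) \<in> C})" by (simp add: open_closed)
  moreover have "- {s. line (F s) \<in> C} = {0}" if "line (F 0) \<notin> C"
    using that lines by fastforce
  ultimately have "open {0 :: complex}" by simp
  then show False using not_open_singleton by blast
qed

text \<open>
  Conjugating by the diagonal endomorphism with entries \<open>1 / s\<close> at \<open>a\<close>, \<open>s\<close> at \<open>b\<close> and \<open>1\<close>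
  elsewhere multiplies the entry \<open>(a, b)\<close> by \<open>1 / s\<^sup>2\<close> and every other entry by a smaller power
  of \<open>1 / s\<close>.  After rescaling by \<open>s\<^sup>2\<close> the family is polynomial in \<open>s\<close>, and at \<open>s = 0\<close> only
  the entry \<open>(a, b)\<close> survives.
\<close>

lemma matrix_unit_if_entry_nonzero:
  assumes x: "x \<in> sl smul B - {0}" "line x \<in> C"
    and ab: "a \<in> B" "b \<in> B" "a \<noteq> b" "entry x a b \<noteq> 0"
  shows "line (matrix_unit a b) \<in> C"
proof -
  define u where "u = (\<lambda>s :: complex. \<lambda>i. if i = a then 1 else if i = b then s\<^sup>2 else s)"
  define w where "w = (\<lambda>s :: complex. \<lambda>j. if j = a then s\<^sup>2 else if j = b then 1 else s)"
  define F where "F = (\<lambda>s. of_entries (\<lambda>i j. u s i * entry x i j * w s j))"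
  have entry_F: "entry (F s) i j = u s i * entry x i j * w s j" if "i \<in> B" "j \<in> B" for s i j
    using that by (simp add: F_def entry_of_entries)
  have x_endo: "x \<in> endos smul" using x sl_endo by blast
  have "line (F 0) \<in> C"
  proof (rule cone_limit)
    show "continuous_map euclidean (endo_topology smul B) F"
    proof (rule continuous_map_into_endo)
      fix i j assume "i \<in> B" "j \<in> B"
      moreover have "continuous_on UNIV (\<lambda>s. u s i * entry x i j * w s j)"
        unfolding u_def w_def
        by (cases "i = a"; cases "i = b"; cases "j = a"; cases "j = b")
           (simp; intro continuous_intros)+
      ultimately show "continuous_map euclidean euclidean (\<lambda>s. entry (F s) i j)"
        by (simp add: entry_F)
    qed (simp add: F_def of_entries_endo)
    fix s
    have "u s i * w s i = s\<^sup>2" for i using ab(3) by (simp add: u_def w_def power2_eq_square)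
    then have "entry (F s) i i = s\<^sup>2 * entry x i i" if "i \<in> B" for i
      using entry_F[OF that that, of s] by (metis mult.assoc mult.commute)
    then have "endo_trace smul B (F s) = s\<^sup>2 * endo_trace smul B x"
      by (simp add: endo_trace_def sum_distrib_left)
    moreover have "entry (F s) a b \<noteq> 0"
      using ab by (simp add: entry_F u_def w_def)
    then have "F s \<noteq> 0" using entry_scale[of 0 "F s" a b] by auto
    ultimately show F_sl: "F s \<in> sl smul B - {0}"
      using x by (simp add: sl_def F_def of_entries_endo)
    assume "s \<noteq> 0"
    define d where "d = (\<lambda>i. if i = a then 1 / s else if i = b then s else 1)"
    have "(\<Prod>i\<in>B. d i) = (\<Prod>i\<in>{a, b}. d i)"
      using ab by (intro prod.mono_neutral_right finite_Basis) (auto simp: d_def)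
    then have d: "(\<Prod>i\<in>B. d i) = 1" "\<And>i. d i \<noteq> 0"
      using ab \<open>s \<noteq> 0\<close> by (auto simp: d_def)
    (* So the entry (i, j) of F s is s\<^sup>2 times that of the conjugate of x, namely d i * x i j / d j. *)
    have uw: "u s i = s * d i" "w s i = s / d i" for i
      using \<open>s \<noteq> 0\<close> ab(3) by (auto simp: u_def w_def d_def power2_eq_square)
    have "F s = endo_scale smul (s\<^sup>2) (Ad smul B (diagonal d) x)"
    proof (rule endo_eqI)
      fix i j assume "i \<in> B" "j \<in> B"
      then show "entry (F s) i j = entry (endo_scale smul (s\<^sup>2) (Ad smul B (diagonal d) x)) i j"
        using d x_endo
        by (simp add: entry_F entry_scale entry_Ad_diagonal uw power2_eq_square)
    qed (use F_sl Ad_sl[OF diagonal_SL[OF d(1)] x(1)] sl_endo endos_scale in auto)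
    then have "line (F s) = line (Ad smul B (diagonal d) x)"
      using \<open>s \<noteq> 0\<close> by (simp add: line_scale)
    then show "line (F s) \<in> C" using cone_invariant[OF diagonal_SL[OF d(1)] x(2)] by simp
  qed
  moreover have "F 0 = endo_scale smul (entry x a b) (matrix_unit a b)"
  proof (rule endo_eqI)
    fix i j assume "i \<in> B" "j \<in> B"
    then show "entry (F 0) i j = entry (endo_scale smul (entry x a b) (matrix_unit a b)) i j"
      using ab(3) by (simp add: entry_F entry_scale entry_matrix_unit u_def w_def)
  qed (simp_all add: F_def of_entries_endo matrix_unit_def endos_scale)
  ultimately show ?thesis using line_scale[OF ab(4)] by simp
qed

lemma matrix_unit_if_conjugate_entry_nonzero:
  assumes x: "x \<in> sl smul B - {0}" "line x \<in> C"
    and "c \<in> B" "d \<in> B" "c \<noteq> d"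
    and "a \<in> B" "b \<in> B" "a \<noteq> b" "entry (Ad smul B (transvection c d 1) x) a b \<noteq> 0"
  shows "line (matrix_unit a b) \<in> C"
proof (rule matrix_unit_if_entry_nonzero)
  have SL: "transvection c d 1 \<in> carrier (SL smul B)" by (rule transvection_SL) fact
  show "Ad smul B (transvection c d 1) x \<in> sl smul B - {0}" by (rule Ad_sl[OF SL x(1)])
  show "line (Ad smul B (transvection c d 1) x) \<in> C" by (rule cone_invariant[OF SL x(2)])
qed (use assms in simp_all)

text \<open>
  A nonzero diagonal endomorphism of trace zero has two distinct eigenvalues, and then a
  transvection makes an off-diagonal entry nonzero.
\<close>

lemma some_matrix_unit:
  assumes "L \<in> C"
  shows "\<exists>a\<in>B. \<exists>b\<in>B. a \<noteq> b \<and> line (matrix_unit a b) \<in> C"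
proof -
  obtain x where x: "x \<in> sl smul B - {0}" "line x \<in> C"
    using assms closedin_subset[OF closed] by (auto simp: topspace_proj_sl)
  then have x_endo: "x \<in> endos smul" using sl_endo by blast
  show ?thesis
  proof (cases "\<exists>a\<in>B. \<exists>b\<in>B. a \<noteq> b \<and> entry x a b \<noteq> 0")
    case True
    then show ?thesis using matrix_unit_if_entry_nonzero[OF x] by blast
  next
    case offdiag: False
    obtain a where a: "a \<in> B" "entry x a a \<noteq> 0"
      using nonzero_entry[OF x_endo] x(1) offdiag by (metis DiffD2 insertI1)
    have "\<exists>b\<in>B. entry x b b \<noteq> entry x a a"
    proof (rule ccontr)
      assume "\<not> ?thesis"
      then have "endo_trace smul B x = (\<Sum>b\<in>B. entry x a a)"
        unfolding endo_trace_def by (intro sum.cong) auto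
      then have "card B = 0" using x(1) a(2) by (simp add: sl_def)
      then show False using a(1) finite_Basis by auto
    qed
    then obtain b where b: "b \<in> B" "entry x b b \<noteq> entry x a a" by blast
    then have "a \<noteq> b" by auto
    moreover have "entry (Ad smul B (transvection a b 1) x) a b \<noteq> 0"
    proof -
      have "entry x a b = 0" "entry x b a = 0" using a b offdiag \<open>a \<noteq> b\<close> by metis+
      then show ?thesis using a b \<open>a \<noteq> b\<close> by (simp add: entry_Ad_transvection x_endo)
    qed
    ultimately have "line (matrix_unit a b) \<in> C"
      using matrix_unit_if_conjugate_entry_nonzero[OF x a(1) b(1) _ a(1) b(1)] by blast
    then show ?thesis using a b \<open>a \<noteq> b\<close> by blast
  qed
qed

text \<open>
  Conjugation by the transvection \<open>1 + E\<^sub>b\<^sub>q\<close> turns \<open>E\<^sub>a\<^sub>b\<close> into \<open>E\<^sub>a\<^sub>b - E\<^sub>a\<^sub>q\<close>;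
  conjugation by \<open>1 + E\<^sub>p\<^sub>a\<close> turns it into \<open>E\<^sub>a\<^sub>b + E\<^sub>p\<^sub>b\<close>.  The new entry can then be
  isolated by a limit.
\<close>

lemma matrix_unit_change_column:
  assumes "a \<in> B" "b \<in> B" "q \<in> B" "a \<noteq> b" "a \<noteq> q" "line (matrix_unit a b) \<in> C"
  shows "line (matrix_unit a q) \<in> C"
proof (cases "b = q")
  case False
  have "entry (Ad smul B (transvection b q 1) (matrix_unit a b)) a q \<noteq> 0"
    using assms False matrix_unit_sl[of a b] by (simp add: entry_Ad_transvection sl_endo entry_matrix_unit)
  then show ?thesis
    using matrix_unit_if_conjugate_entry_nonzero[OF matrix_unit_sl assms(6)] assms False by blast
qed (use assms in simp)

lemma matrix_unit_change_row:
  assumes "a \<in> B" "b \<in> B" "p \<in> B" "a \<noteq> b" "p \<noteq> b" "line (matrix_unit a b) \<in> C"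
  shows "line (matrix_unit p b) \<in> C"
proof (cases "a = p")
  case False
  have "entry (Ad smul B (transvection p a 1) (matrix_unit a b)) p b \<noteq> 0"
    using assms False matrix_unit_sl[of a b] by (simp add: entry_Ad_transvection sl_endo entry_matrix_unit)
  then show ?thesis
    using matrix_unit_if_conjugate_entry_nonzero[OF matrix_unit_sl assms(6)] assms False by blast
qed (use assms in simp)

text \<open>
  Changing one index at a time cannot interchange the two indices when the space is a plane, as an
  intermediate step would be a diagonal matrix unit, which has trace one.
\<close>

lemma matrix_unit_transpose:
  assumes "p \<in> B" "q \<in> B" "p \<noteq> q" "line (matrix_unit q p) \<in> C"
  shows "line (matrix_unit p q) \<in> C"
proof -
  have "entry (Ad smul B (transvection p q 1) (matrix_unit q p)) p q \<noteq> 0"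
    using assms matrix_unit_sl[of q p] by (simp add: entry_Ad_transvection sl_endo entry_matrix_unit)
  then show ?thesis
    using matrix_unit_if_conjugate_entry_nonzero[OF matrix_unit_sl assms(4)] assms by blast
qed

lemma all_matrix_units:
  assumes "L \<in> C" and pq: "p \<in> B" "q \<in> B" "p \<noteq> q"
  shows "line (matrix_unit p q) \<in> C"
proof -
  obtain a b where ab: "a \<in> B" "b \<in> B" "a \<noteq> b" "line (matrix_unit a b) \<in> C"
    using some_matrix_unit[OF assms(1)] by blast
  consider "a \<noteq> q" | "a = q" "b = p" | "a = q" "b \<noteq> p" by blast
  then show ?thesis
  proof cases
    case 1
    then have "line (matrix_unit a q) \<in> C" using matrix_unit_change_column ab pq by blast
    then show ?thesis using matrix_unit_change_row 1 ab pq by blast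
  next
    case 2
    then show ?thesis using matrix_unit_transpose ab pq by blast
  next
    case 3
    then have "line (matrix_unit p b) \<in> C" using matrix_unit_change_row ab pq by blast
    then show ?thesis using matrix_unit_change_column 3 ab pq by blast
  qed
qed

end

theorem group_liouville_SL:
  "group_liouville (SL smul B) (SL_topology smul B) (proj_sl smul B) (\<lambda>g L. Ad smul B g ` L)"
proof -
  have "\<exists>z. \<forall>C. closedin (proj_sl smul B) C \<and> C \<noteq> {} \<and>
      (\<forall>g\<in>carrier (SL smul B). \<forall>L\<in>C. Ad smul B g ` L \<in> C) \<longrightarrow> z \<in> C"
  proof (cases "\<exists>p\<in>B. \<exists>q\<in>B. p \<noteq> q")
    case True
    then obtain p q where "p \<in> B" "q \<in> B" "p \<noteq> q" by blast
    have "line (matrix_unit p q) \<in> C"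
      if C: "closedin (proj_sl smul B) C" "\<forall>g\<in>carrier (SL smul B). \<forall>L\<in>C. Ad smul B g ` L \<in> C"
        and L: "L \<in> C" for C L
      by (rule all_matrix_units[OF C(1) _ L]) (use C(2) \<open>p \<in> B\<close> \<open>q \<in> B\<close> \<open>p \<noteq> q\<close> in auto)
    then show ?thesis by blast
  next
    (* In dimension at most one there are no nonzero endomorphisms of trace zero, so no nonempty C. *)
    case False
    have "L \<notin> C"
      if C: "closedin (proj_sl smul B) C" "\<forall>g\<in>carrier (SL smul B). \<forall>L\<in>C. Ad smul B g ` L \<in> C"
      for C L
    proof
      assume L: "L \<in> C"
      have "\<exists>a\<in>B. \<exists>b\<in>B. a \<noteq> b \<and> line (matrix_unit a b) \<in> C"
        by (rule some_matrix_unit[OF C(1) _ L]) (use C(2) in auto)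
      then show False using False by blast
    qed
    then show ?thesis by blast
  qed
  then obtain z where z: "\<forall>C. closedin (proj_sl smul B) C \<and> C \<noteq> {} \<and>
      (\<forall>g\<in>carrier (SL smul B). \<forall>L\<in>C. Ad smul B g ` L \<in> C) \<longrightarrow> z \<in> C" ..
  show ?thesis
  proof (rule group_liouville_if_point_in_closed_invariant_sets[OF group_SL topspace_SL compact_proj_sl, where z = z])
    show "Ad smul B g ` L \<in> topspace (proj_sl smul B)"
      if g: "g \<in> carrier (SL smul B)" and L: "L \<in> topspace (proj_sl smul B)" for g L
    proof -
      obtain x where x: "x \<in> sl smul B - {0}" "L = line x"
        using L unfolding topspace_proj_sl by blast
      show ?thesis
        unfolding x(2) Ad_line[OF g] topspace_proj_sl by (rule imageI[OF Ad_sl[OF g x(1)]])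
    qed
    show "Ad smul B (g \<otimes>\<^bsub>SL smul B\<^esub> h) ` L = Ad smul B g ` (Ad smul B h ` L)"
      if "g \<in> carrier (SL smul B)" "h \<in> carrier (SL smul B)" for g h L
      unfolding Ad_mult[OF that] image_image ..
    show "continuous_map (SL_topology smul B) (proj_sl smul B) (\<lambda>g. Ad smul B g ` L)"
      if L: "L \<in> topspace (proj_sl smul B)" for L
    proof -
      obtain x where x: "x \<in> sl smul B - {0}" "L = line x"
        using L unfolding topspace_proj_sl by blast
      have "continuous_map (SL_topology smul B) (proj_sl smul B) (\<lambda>g. line (Ad smul B g x))"
        unfolding topspace_SL[symmetric]
        by (intro continuous_map_line_comp continuous_map_Ad Ad_sl[OF _ x(1)])
           (use x(1) sl_endo in \<open>simp_all add: topspace_SL\<close>)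
      then show ?thesis
        by (rule continuous_map_eq) (simp only: topspace_SL Ad_line x(2))
    qed
    show "z \<in> C"
      if "closedin (proj_sl smul B) C" "C \<noteq> {}"
        "\<And>g L. g \<in> carrier (SL smul B) \<Longrightarrow> L \<in> C \<Longrightarrow> Ad smul B g ` L \<in> C" for C
      by (rule z[rule_format]) (intro conjI ballI that)
  qed
qed

end

theorem theorem1p4:
  fixes smul :: "complex \<Rightarrow> 'v::ab_group_add \<Rightarrow> 'v" and B :: "'v set"
  assumes "finite_dimensional_vector_space smul B"
  shows "group_liouville (SL smul B) (SL_topology smul B)
           (proj_sl smul B) (\<lambda>g L. Ad smul B g ` L)"
proof -
  interpret finite_dimensional_vector_space smul B by fact
  interpret complex_basis smul B ..
  show ?thesis by (rule group_liouville_SL)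
qed

end
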